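(* Let $H$ be a separable Hilbert space and let $\{x_n\}_{n\in\mathbb{N}}\subseteq H$ be a sequence of nonzero elements for which $\|x_n\|\to \infty$ as $n\to\infty$. Assume that there exists an infinite-dimensional closed subspace $M$ of $H$ such that $\{P_Mx_n\}$ is a Bessel sequence in $M$. Then $\{x_n\}$ is not lower-normalizable.
   Context: $P_M$ is the orthogonal projection of $H$ onto $M$. A sequence $\{z_n\}$ in a Hilbert space $K$ is a Bessel sequence in $K$ if there is a constant $B$ with $\sum_n|\langle x,z_n\rangle|^2\le B\|x\|^2$ for all $x\in K$. A sequence $\{x_n\}$ of nonzero elements of $H$ is lower-normalizable if there is a constant $A>0$ such that $\sum_n\bigl|\bigl\langle x,\frac{x_n}{\|x_n\|}\bigr\rangle\bigr|^2\ge A\|x\|^2$ for all $x\in H$ (the sum being allowed to be $+\infty$). *)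

theory Defs
  imports "HOL-Analysis.Analysis"
begin

text \<open>
  Scalars: the law \<open>c * scnj c = \<bar>c\<bar>\<^sup>2\<close> makes every element at most quadratic over the
  reals (its trace \<open>c + scnj c = \<bar>c + 1\<bar>\<^sup>2 - \<bar>c\<bar>\<^sup>2 - 1\<close> is real), so up to isomorphism the only
  fields in this class are the reals and the complex numbers with their usual conjugations.
\<close>

class rc_field = real_normed_field +
  fixes scnj :: "'a \<Rightarrow> 'a"
  assumes scnj_add: "scnj (a + b) = scnj a + scnj b"
    and scnj_mult: "scnj (a * b) = scnj a * scnj b"
    and scnj_scnj: "scnj (scnj a) = a"
    and mult_scnj: "a * scnj a = (norm a)\<^sup>2 *\<^sub>R 1"

instantiation real :: rc_field
begin
definition scnj_real :: "real \<Rightarrow> real" where "scnj_real a = a"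
instance
  by standard (simp_all add: scnj_real_def power2_eq_square)
end

instantiation complex :: rc_field
begin
definition scnj_complex :: "complex \<Rightarrow> complex" where "scnj_complex a = cnj a"
instance
proof
  fix a :: complex
  show "a * scnj a = (norm a)\<^sup>2 *\<^sub>R 1"
    by (simp only: scnj_complex_def scaleR_conv_of_real complex_norm_square mult_1_right)
qed (simp_all add: scnj_complex_def)
end

text \<open>
  A Hilbert space over \<open>'k\<close> is the whole type \<open>'a\<close>, whose norm is the one induced by the
  inner product \<open>ip\<close> (linear in its first argument) and is complete.
\<close>

locale hilbert_space = vector_space smul
  for smul :: "'k::rc_field \<Rightarrow> 'a::{real_normed_vector, complete_space} \<Rightarrow> 'a" +
  fixes ip :: "'a \<Rightarrow> 'a \<Rightarrow> 'k"
  assumes smul_of_real: "smul (of_real r) x = r *\<^sub>R x"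
    and ip_add_left: "ip (x + y) z = ip x z + ip y z"
    and ip_smul_left: "ip (smul c x) z = c * ip x z"
    and ip_commute: "ip x y = scnj (ip y x)"
    and ip_self: "ip x x = of_real ((norm x)\<^sup>2)"

lemma hilbert_space_real_inner:
  "hilbert_space (scaleR :: real \<Rightarrow> 'a \<Rightarrow> 'a) (inner :: 'a::{real_inner, complete_space} \<Rightarrow> 'a \<Rightarrow> real)"
proof
  fix x y :: 'a
  show "inner x y = scnj (inner y x)"
    by (simp only: scnj_real_def inner_commute)
  show "inner x x = of_real ((norm x)\<^sup>2)"
    by (simp add: power2_norm_eq_inner)
qed (simp_all add: scaleR_add_right scaleR_add_left inner_add_left)

lemma hilbert_space_complex:
  "hilbert_space (*) (\<lambda>x y :: complex. x * cnj y)"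
proof
  fix x :: complex
  show "x * cnj x = of_real ((norm x)\<^sup>2)"
    by (simp only: complex_norm_square)
qed (simp_all add: distrib_left distrib_right scnj_complex_def scaleR_conv_of_real)

definition infinite_dimensional :: "('k::field \<Rightarrow> 'a::ab_group_add \<Rightarrow> 'a) \<Rightarrow> 'a set \<Rightarrow> bool" where
  "infinite_dimensional smul M \<longleftrightarrow> \<not> (\<exists>B. finite B \<and> module.span smul B = M)"

definition orth_proj :: "('a::ab_group_add \<Rightarrow> 'a \<Rightarrow> 'k::zero) \<Rightarrow> 'a set \<Rightarrow> 'a \<Rightarrow> 'a" where
  "orth_proj ip M x = (THE p. p \<in> M \<and> (\<forall>m\<in>M. ip (x - p) m = 0))"

text \<open>Sums of squares are taken in the extended nonnegative reals, so they may be infinite.\<close>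

definition bessel_sequence_in ::
  "('a::real_normed_vector \<Rightarrow> 'a \<Rightarrow> 'k::real_normed_field) \<Rightarrow> 'a set \<Rightarrow> (nat \<Rightarrow> 'a) \<Rightarrow> bool" where
  "bessel_sequence_in ip K z \<longleftrightarrow>
     (\<forall>n. z n \<in> K) \<and>
     (\<exists>B\<ge>0. \<forall>x\<in>K. (\<Sum>n. ennreal ((norm (ip x (z n)))\<^sup>2)) \<le> ennreal (B * (norm x)\<^sup>2))"

definition lower_normalizable ::
  "('a::real_normed_vector \<Rightarrow> 'a \<Rightarrow> 'k::real_normed_field) \<Rightarrow> (nat \<Rightarrow> 'a) \<Rightarrow> bool" where
  "lower_normalizable ip x \<longleftrightarrow>
     (\<forall>n. x n \<noteq> 0) \<and>
     (\<exists>A>0. \<forall>y. ennreal (A * (norm y)\<^sup>2) \<le> (\<Sum>n. ennreal ((norm (ip y (x n /\<^sub>R norm (x n))))\<^sup>2)))"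

end

theory Submission
  imports Defs
begin

text \<open>
  Suppose the normalized sequence had lower bound \<open>A\<close>, and let \<open>B\<close> be the Bessel bound of the
  projected sequence. As \<open>M\<close> is infinite-dimensional, it contains a nonzero \<open>m\<close> orthogonal to
  the finitely many \<open>x n\<close> with \<open>\<parallel>x n\<parallel>\<^sup>2 < (B + 1) / A\<close>. The other terms satisfy
  \<open>\<langle>m, x n\<rangle> = \<langle>m, P x n\<rangle>\<close>, so the normalized sum at \<open>m\<close> is at most
  \<open>A / (B + 1) * B * \<parallel>m\<parallel>\<^sup>2 < A * \<parallel>m\<parallel>\<^sup>2\<close>.
\<close>

section \<open>Conjugation on the scalar field\<close>

lemma scnj_zero [simp]: "scnj (0 :: 'k::rc_field) = 0"
  using scnj_add[of "0::'k" 0] by simp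

lemma scnj_minus: "scnj (- a :: 'k::rc_field) = - scnj a"
  using scnj_add[of a "- a"] by (simp add: add_eq_0_iff)

text \<open>Taking norms in \<open>mult_scnj\<close> and cancelling \<open>norm a\<close>.\<close>

lemma norm_scnj [simp]: "norm (scnj a :: 'k::rc_field) = norm a"
proof (cases "a = 0")
  case False
  have "norm a * norm (scnj a) = norm a * norm a"
    by (metis mult_scnj norm_mult norm_one norm_scaleR mult_1_right power2_eq_square abs_of_nonneg
        zero_le_square)
  with False show ?thesis by simp
qed simp

section \<open>Algebra of the inner product\<close>

context hilbert_space
begin

lemma ip_add_right: "ip x (y + z) = ip x y + ip x z"
  by (metis ip_add_left ip_commute scnj_add)

lemma ip_smul_right: "ip x (smul c y) = scnj c * ip x y"
  by (metis ip_smul_left ip_commute scnj_mult)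

lemma ip_zero_left [simp]: "ip 0 y = 0"
  using ip_add_left[of 0 0 y] by simp

lemma ip_minus_left: "ip (- x) y = - ip x y"
  using ip_add_left[of x "- x" y] by (simp add: add_eq_0_iff)

lemma ip_minus_right: "ip x (- y) = - ip x y"
  by (metis ip_minus_left ip_commute scnj_minus)

lemma ip_diff_left: "ip (x - y) z = ip x z - ip y z"
  using ip_add_left[of x "- y" z] by (simp add: ip_minus_left)

lemma ip_diff_right: "ip x (y - z) = ip x y - ip x z"
  using ip_add_right[of x y "- z"] by (simp add: ip_minus_right)

lemma ip_self_eq_0_iff: "ip x x = 0 \<longleftrightarrow> x = 0"
  by (simp add: ip_self)

lemma ip_eq_0_commute: "ip x y = 0 \<Longrightarrow> ip y x = 0"
  by (subst ip_commute) simp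

lemma norm_ip_scaleR_right: "norm (ip x (r *\<^sub>R y)) = \<bar>r\<bar> * norm (ip x y)"
  by (simp add: smul_of_real[symmetric] ip_smul_right norm_mult)

lemma parallelogram_law:
  fixes x y :: 'a
  shows "(norm (x + y))\<^sup>2 + (norm (x - y))\<^sup>2 = 2 * (norm x)\<^sup>2 + 2 * (norm y)\<^sup>2"
proof -
  have "(of_real ((norm (x + y))\<^sup>2 + (norm (x - y))\<^sup>2) :: 'k)
      = ip (x + y) (x + y) + ip (x - y) (x - y)"
    by (simp add: ip_self)
  also have "\<dots> = 2 * ip x x + 2 * ip y y"
    by (simp add: ip_add_left ip_add_right ip_diff_left ip_diff_right)
  also have "\<dots> = of_real (2 * (norm x)\<^sup>2 + 2 * (norm y)\<^sup>2)"
    by (simp add: ip_self)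
  finally show ?thesis by (simp only: of_real_eq_iff)
qed

text \<open>Pythagoras: subtracting the component along a unit vector removes exactly its share of
  the squared norm. This is what forces a nearest point to have an orthogonal residual.\<close>

lemma norm_diff_smul_ip:
  assumes "norm m = 1"
  shows "(norm (u - smul (ip u m) m))\<^sup>2 = (norm u)\<^sup>2 - (norm (ip u m))\<^sup>2"
proof -
  let ?c = "ip u m"
  have cc: "?c * scnj ?c = of_real ((norm ?c)\<^sup>2)"
    by (simp add: mult_scnj scaleR_conv_of_real)
  have "(of_real ((norm (u - smul ?c m))\<^sup>2) :: 'k) = ip (u - smul ?c m) (u - smul ?c m)"
    by (simp add: ip_self)
  also have "\<dots> = ip u u - scnj ?c * ?c - ?c * ip m u + ?c * scnj ?c * ip m m"
    by (simp add: ip_diff_left ip_diff_right ip_smul_left ip_smul_right algebra_simps)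
  also have "\<dots> = ip u u - ?c * scnj ?c"
    using assms ip_commute[of m u] by (simp add: ip_self)
  also have "\<dots> = of_real ((norm u)\<^sup>2 - (norm ?c)\<^sup>2)"
    by (simp add: cc ip_self)
  finally show ?thesis by (simp only: of_real_eq_iff)
qed

section \<open>Orthogonal projection onto a closed subspace\<close>

lemma subspace_scaleR:
  assumes "subspace M" "y \<in> M"
  shows "r *\<^sub>R y \<in> M"
  using subspace_scale[OF assms, of "of_real r"] by (simp add: smul_of_real)

text \<open>A minimizing sequence is Cauchy by the parallelogram law; completeness gives a limit,
  and closedness keeps it in \<open>M\<close>.\<close>

lemma nearest_point_exists:
  assumes M: "subspace M" and "closed M"
  shows "\<exists>p\<in>M. \<forall>m\<in>M. norm (x - p) \<le> norm (x - m)"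
proof -
  let ?f = "\<lambda>m. (norm (x - m))\<^sup>2"
  define d where "d = (INF m\<in>M. ?f m)"
  have bdd: "bdd_below (?f ` M)" by (rule bdd_belowI2[of _ 0]) simp
  have ne: "M \<noteq> {}" using subspace_0[OF M] by blast
  have d_le: "d \<le> ?f m" if "m \<in> M" for m
    unfolding d_def by (rule cINF_lower[OF bdd that])
  have "\<exists>m\<in>M. ?f m < d + inverse (real (Suc n))" for n
    using cINF_less_iff[OF ne bdd, of "d + inverse (real (Suc n))"] by (simp add: d_def)
  then obtain s where sM: "s n \<in> M" and s: "?f (s n) < d + inverse (real (Suc n))" for n
    by metis
  \<comment> \<open>The parallelogram law is applied to \<open>x - a\<close> and
    \<open>x - b\<close>; half their sum is \<open>x\<close> minus the midpoint of \<open>a\<close>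
    and \<open>b\<close>, which lies in \<open>M\<close> and so has squared distance at least
    \<open>d\<close> from \<open>x\<close>.\<close>
  have dist: "(norm (a - b))\<^sup>2 \<le> 2 * ?f a + 2 * ?f b - 4 * d" if "a \<in> M" "b \<in> M" for a b
  proof -
    have mid: "(1/2) *\<^sub>R (a + b) \<in> M"
      by (intro subspace_scaleR[OF M] subspace_add[OF M] that)
    have "(x - a) + (x - b) = 2 *\<^sub>R (x - (1/2) *\<^sub>R (a + b))"
      by (simp add: algebra_simps scaleR_2)
    then have "(norm ((x - a) + (x - b)))\<^sup>2 = 4 * ?f ((1/2) *\<^sub>R (a + b))"
      by (simp only: norm_scaleR power_mult_distrib) simp
    moreover have "norm ((x - a) - (x - b)) = norm (a - b)"
      by (simp add: norm_minus_commute)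
    ultimately show ?thesis
      using parallelogram_law[of "x - a" "x - b"] d_le[OF mid] by simp
  qed
  have "Cauchy s"
  proof (rule metric_CauchyI)
    fix e :: real assume "0 < e"
    \<comment> \<open>With both squared distances below \<open>d + e^2 / 4\<close>, the bound in
      \<open>dist\<close> falls below \<open>e^2\<close>.\<close>
    then obtain N where N: "inverse (real (Suc N)) < e\<^sup>2 / 4"
      using reals_Archimedean[of "e\<^sup>2 / 4"] by auto
    have small: "?f (s n) < d + e\<^sup>2 / 4" if "n \<ge> N" for n
    proof -
      have "inverse (real (Suc n)) \<le> inverse (real (Suc N))"
        using that by (intro le_imp_inverse_le) auto
      then show ?thesis using s[of n] N by linarith
    qed
    have "dist (s m) (s n) < e" if "m \<ge> N" "n \<ge> N" for m n
    proof -
      have "(norm (s m - s n))\<^sup>2 < e\<^sup>2"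
        using dist[OF sM sM, of m n] small[OF that(1)] small[OF that(2)] by linarith
      then show ?thesis
        using \<open>0 < e\<close> by (simp add: dist_norm power_less_imp_less_base)
    qed
    then show "\<exists>N. \<forall>m\<ge>N. \<forall>n\<ge>N. dist (s m) (s n) < e" by blast
  qed
  then obtain p where p: "s \<longlonglongrightarrow> p"
    using Cauchy_convergent convergent_def by blast
  have pM: "p \<in> M"
    using closed_sequentially[OF \<open>closed M\<close> _ p] sM by blast
  have "(\<lambda>n. ?f (s n)) \<longlonglongrightarrow> ?f p"
    by (intro tendsto_intros p)
  moreover have "(\<lambda>n. d + inverse (real (Suc n))) \<longlonglongrightarrow> d"
    using LIMSEQ_inverse_real_of_nat_add by simp
  ultimately have fp: "?f p \<le> d"
    by (rule LIMSEQ_le) (use s in \<open>auto intro: less_imp_le\<close>)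
  have "norm (x - p) \<le> norm (x - m)" if "m \<in> M" for m
    using order_trans[OF fp d_le[OF that]] by (rule power2_le_imp_le) simp
  with pM show ?thesis by blast
qed

text \<open>If the residual at the nearest point had a component along a unit vector of
  \<open>M\<close>, moving by that component would come closer to \<open>x\<close>. Scaling extends
  this from unit vectors to all of \<open>M\<close>.\<close>

lemma orthogonal_projection_exists:
  assumes M: "subspace M" and "closed M"
  shows "\<exists>p\<in>M. \<forall>m\<in>M. ip (x - p) m = 0"
proof -
  obtain p where pM: "p \<in> M" and near: "\<And>m. m \<in> M \<Longrightarrow> norm (x - p) \<le> norm (x - m)"
    using nearest_point_exists[OF assms] by blast
  have unit: "ip (x - p) m = 0" if m: "m \<in> M" "norm m = 1" for m
  proof -
    let ?c = "ip (x - p) m"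
    have "p + smul ?c m \<in> M"
      by (intro subspace_add[OF M] subspace_scale[OF M] pM m)
    from near[OF this] have "(norm (x - p))\<^sup>2 \<le> (norm (x - p - smul ?c m))\<^sup>2"
      by (simp add: power_mono diff_diff_eq)
    then show ?thesis using norm_diff_smul_ip[OF m(2), of "x - p"] by simp
  qed
  have "ip (x - p) m = 0" if m: "m \<in> M" for m
  proof (cases "m = 0")
    case True
    then show ?thesis by (simp add: ip_eq_0_commute)
  next
    case False
    then have "ip (x - p) (inverse (norm m) *\<^sub>R m) = 0"
      by (intro unit subspace_scaleR[OF M m]) simp
    then have "inverse (norm m) * norm (ip (x - p) m) = 0"
      using norm_ip_scaleR_right[of "x - p" "inverse (norm m)" m] by simp
    with False show ?thesis by simp
  qed
  with pM show ?thesis by blast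
qed

text \<open>The description in \<open>orth_proj\<close> needs uniqueness: the difference of two
  candidates lies in \<open>M\<close> and is orthogonal to itself.\<close>

lemma ip_orth_proj:
  assumes M: "subspace M" and "closed M" and m: "m \<in> M"
  shows "ip m (orth_proj ip M x) = ip m x"
proof -
  let ?P = "\<lambda>p. p \<in> M \<and> (\<forall>m\<in>M. ip (x - p) m = 0)"
  have "\<exists>!p. ?P p"
  proof (rule ex_ex1I)
    show "\<exists>p. ?P p" using orthogonal_projection_exists[OF assms(1,2)] by blast
    fix p q assume p: "?P p" and q: "?P q"
    then have "p - q \<in> M" using subspace_diff[OF M] by blast
    then have "ip (x - q) (p - q) - ip (x - p) (p - q) = 0" using p q by simp
    then have "ip (p - q) (p - q) = 0" by (simp add: ip_diff_left)
    then show "p = q" by (simp add: ip_self_eq_0_iff)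
  qed
  from theI'[OF this] have "ip (x - orth_proj ip M x) m = 0"
    using m by (simp add: orth_proj_def)
  then have "ip m (x - orth_proj ip M x) = 0" by (rule ip_eq_0_commute)
  then show ?thesis by (simp add: ip_diff_right)
qed

section \<open>Finitely many orthogonality conditions on an infinite-dimensional subspace\<close>

text \<open>One condition lowers the dimension by at most one: a finite spanning set of the smaller
  space, together with one \<open>v\<close> in \<open>M\<close> violating the condition, would span
  \<open>M\<close>.\<close>

lemma infinite_dimensional_inter_orthogonal:
  assumes M: "subspace M" and inf: "infinite_dimensional smul M"
  shows "infinite_dimensional smul {m \<in> M. ip m y = 0}"
proof (cases "\<forall>m\<in>M. ip m y = 0")
  case True
  then have "{m \<in> M. ip m y = 0} = M" by blast
  with inf show ?thesis by simp
next
  case False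
  then obtain v where v: "v \<in> M" "ip v y \<noteq> 0" by blast
  show ?thesis
    unfolding infinite_dimensional_def
  proof
    assume "\<exists>B. finite B \<and> span B = {m \<in> M. ip m y = 0}"
    then obtain B where B: "finite B" "span B = {m \<in> M. ip m y = 0}" by blast
    have "span (insert v B) = M"
    proof
      have "B \<subseteq> M" using span_superset[of B] B(2) by blast
      then show "span (insert v B) \<subseteq> M" using v by (intro span_minimal M) auto
      show "M \<subseteq> span (insert v B)"
      proof
        fix m assume m: "m \<in> M"
        \<comment> \<open>This coefficient makes \<open>m - smul c v\<close> orthogonal to
          \<open>y\<close>.\<close>
        define c where "c = ip m y / ip v y"
        have "m - smul c v \<in> M"
          by (intro subspace_diff[OF M] subspace_scale[OF M] m v)
        moreover have "ip (m - smul c v) y = 0"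
          using v by (simp add: ip_diff_left ip_smul_left c_def)
        ultimately have "m - smul c v \<in> span B" using B by blast
        then show "m \<in> span (insert v B)" by (auto simp: span_insert)
      qed
    qed
    with B(1) inf show False by (auto simp: infinite_dimensional_def)
  qed
qed

lemma infinite_dimensional_inter_finite_orthogonal:
  fixes N :: nat
  assumes M: "subspace M" and inf: "infinite_dimensional smul M"
  shows "subspace {m \<in> M. \<forall>i<N. ip m (y i) = 0}
    \<and> infinite_dimensional smul {m \<in> M. \<forall>i<N. ip m (y i) = 0}"
proof (induction N)
  case 0
  with assms show ?case by simp
next
  case (Suc N)
  let ?M = "{m \<in> M. \<forall>i<N. ip m (y i) = 0}"
  have eq: "{m \<in> M. \<forall>i<Suc N. ip m (y i) = 0} = {m \<in> ?M. ip m (y N) = 0}"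
    by (auto simp: less_Suc_eq)
  have "subspace {m \<in> ?M. ip m (y N) = 0}"
    using M by (auto simp: subspace_def ip_add_left ip_smul_left)
  then show ?case
    unfolding eq using infinite_dimensional_inter_orthogonal Suc by blast
qed

text \<open>The zero space is spanned by the empty set, so an infinite-dimensional subspace contains
  a nonzero vector.\<close>

lemma infinite_dimensional_obtain_orthogonal:
  fixes N :: nat
  assumes "subspace M" "infinite_dimensional smul M"
  obtains m where "m \<in> M" "m \<noteq> 0" "\<And>i. i < N \<Longrightarrow> ip m (y i) = 0"
proof -
  let ?M = "{m \<in> M. \<forall>i<N. ip m (y i) = 0}"
  have sub: "subspace ?M" and inf: "infinite_dimensional smul ?M"
    using infinite_dimensional_inter_finite_orthogonal[OF assms] by auto
  from inf have "?M \<noteq> {0}"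
    unfolding infinite_dimensional_def using span_empty finite.emptyI by metis
  then show ?thesis using that subspace_0[OF sub] by blast
qed

end

theorem theorem3p23:
  fixes smul :: "'k::rc_field \<Rightarrow> 'a::{real_normed_vector, complete_space} \<Rightarrow> 'a"
    and ip :: "'a \<Rightarrow> 'a \<Rightarrow> 'k"
    and x :: "nat \<Rightarrow> 'a"
  assumes "hilbert_space smul ip"
    and separable: "\<exists>D :: 'a set. countable D \<and> closure D = UNIV"
    and nonzero: "\<And>n. x n \<noteq> 0"
    and "filterlim (\<lambda>n. norm (x n)) at_top sequentially"
    and "\<exists>M. module.subspace smul M \<and> closed M \<and> infinite_dimensional smul M \<and>
             bessel_sequence_in ip M (\<lambda>n. orth_proj ip M (x n))"
  shows "\<not> lower_normalizable ip x"
proof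
  interpret hilbert_space smul ip by fact
  assume "lower_normalizable ip x"
  then obtain A where "A > 0" and
    A: "\<And>y. ennreal (A * (norm y)\<^sup>2) \<le> (\<Sum>n. ennreal ((norm (ip y (x n /\<^sub>R norm (x n))))\<^sup>2))"
    unfolding lower_normalizable_def by blast
  obtain M where M: "subspace M" "closed M" "infinite_dimensional smul M"
    and bessel: "bessel_sequence_in ip M (\<lambda>n. orth_proj ip M (x n))"
    using assms(5) by blast
  obtain B where "B \<ge> 0" and
    B: "\<And>y. y \<in> M \<Longrightarrow>
      (\<Sum>n. ennreal ((norm (ip y (orth_proj ip M (x n))))\<^sup>2)) \<le> ennreal (B * (norm y)\<^sup>2)"
    using bessel unfolding bessel_sequence_in_def by blast
  \<comment> \<open>The threshold for the squared norms, chosen so that \<open>A * c\<close> exceeds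
    \<open>B\<close>.\<close>
  define c where "c = (B + 1) / A"
  have "c > 0" using \<open>A > 0\<close> \<open>B \<ge> 0\<close> by (simp add: c_def)
  \<comment> \<open>The lower bound 1 ensures that squaring does not decrease the norm, so the bound
    \<open>c\<close> passes to the squared norm.\<close>
  obtain N where N: "\<And>n. n \<ge> N \<Longrightarrow> max 1 c \<le> norm (x n)"
    using assms(4) unfolding filterlim_at_top eventually_sequentially by meson
  have large: "c \<le> (norm (x n))\<^sup>2" if "n \<ge> N" for n
    using N[OF that] self_le_power[of "norm (x n)" 2] by simp
  obtain m where m: "m \<in> M" "m \<noteq> 0" and orth: "\<And>i. i < N \<Longrightarrow> ip m (x i) = 0"
    using infinite_dimensional_obtain_orthogonal[OF M(1,3), of N x] by metis
  \<comment> \<open>Both sides vanish for \<open>n < N\<close>. For later \<open>n\<close> the inner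
    products with \<open>x n\<close> and its projection agree, and normalizing costs a factor of at
    most \<open>inverse c\<close>.\<close>
  have le: "(norm (ip m (x n /\<^sub>R norm (x n))))\<^sup>2
      \<le> inverse c * (norm (ip m (orth_proj ip M (x n))))\<^sup>2" for n
  proof (cases "n < N")
    case True
    then show ?thesis
      by (simp add: norm_ip_scaleR_right orth ip_orth_proj[OF M(1,2) m(1)])
  next
    case False
    then have "inverse ((norm (x n))\<^sup>2) \<le> inverse c"
      using large[of n] \<open>c > 0\<close> by (intro le_imp_inverse_le) auto
    then show ?thesis
      by (simp add: norm_ip_scaleR_right ip_orth_proj[OF M(1,2) m(1)] power_mult_distrib
          power_inverse mult_right_mono)
  qed
  have "ennreal (A * (norm m)\<^sup>2) \<le> (\<Sum>n. ennreal ((norm (ip m (x n /\<^sub>R norm (x n))))\<^sup>2))"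
    by (rule A)
  also have "\<dots> \<le> (\<Sum>n. ennreal (inverse c) * ennreal ((norm (ip m (orth_proj ip M (x n))))\<^sup>2))"
    using \<open>c > 0\<close> le by (intro suminf_le summableI) (simp add: ennreal_mult[symmetric] ennreal_leI)
  also have "\<dots> = ennreal (inverse c) * (\<Sum>n. ennreal ((norm (ip m (orth_proj ip M (x n))))\<^sup>2))"
    by (rule ennreal_suminf_cmult)
  also have "\<dots> \<le> ennreal (inverse c) * ennreal (B * (norm m)\<^sup>2)"
    by (intro mult_left_mono B m) simp
  also have "\<dots> = ennreal (inverse c * (B * (norm m)\<^sup>2))"
    using \<open>c > 0\<close> \<open>B \<ge> 0\<close> by (simp add: ennreal_mult)
  finally have "A * (norm m)\<^sup>2 \<le> inverse c * (B * (norm m)\<^sup>2)"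
    using \<open>c > 0\<close> \<open>B \<ge> 0\<close> by (simp add: ennreal_le_iff)
  then have "A \<le> inverse c * B"
    using m(2) by (simp add: mult.assoc[symmetric])
  then have "A * c \<le> B"
    using \<open>c > 0\<close> by (simp add: field_simps)
  \<comment> \<open>By the choice of \<open>c\<close>, the left side is
    \<open>B + 1\<close>.\<close>
  then show False
    using \<open>A > 0\<close> by (simp add: c_def)
qed

end
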